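(* Let $n\ge 1$ and let $F_n = K_1\vee P_n$ be the fan graph. The number of switching classes of signatures of $F_n$ that maximise the frustration index (i.e. with $l(F_n,\sigma)=l_{\max}(F_n)$) is $2^{\frac{n}{2}-1}$ when $n$ is even, and $\frac{n+3}{2}\times 2^{\frac{n-3}{2}}$ when $n$ is odd.
   Context: All graphs are finite, simple and undirected. A signed graph $\Sigma=(G,\sigma)$ is a graph $G$ with a signature $\sigma:E(G)\to\{+1,-1\}$. The sign of a cycle is the product of the signs of its edges; $\Sigma$ is balanced if all its cycles are positive. The frustration index $l(\Sigma)$ is the minimum number of edges whose deletion makes $\Sigma$ balanced; it is invariant under switching. $l_{\max}(G)=\max_\sigma l(G,\sigma)$. Switching $\Sigma$ at a vertex subset $X$ negates the signs of all edges with exactly one endpoint in $X$; two signatures of $G$ are switching equivalent if one is obtained from the other by switching, and a switching class is an equivalence class of signatures of the (labelled) graph $G$ under this relation. $P_n$ is the path on $n$ vertices and $\vee$ denotes the join of vertex-disjoint graphs. *)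

theory Defs
  imports Complex_Main "HOL-Library.FuncSet"
begin

record 'a graph =
  verts :: "'a set"
  edges :: "'a set set"

definition simple_graph :: "'a graph \<Rightarrow> bool" where
  "simple_graph G \<longleftrightarrow> finite (verts G) \<and> (\<forall>e\<in>edges G. e \<subseteq> verts G \<and> card e = 2)"

definition delete_edges :: "'a graph \<Rightarrow> 'a set set \<Rightarrow> 'a graph" where
  "delete_edges G D = \<lparr>verts = verts G, edges = edges G - D\<rparr>"

definition complete_graph :: "'a set \<Rightarrow> 'a graph" where
  "complete_graph S = \<lparr>verts = S, edges = {{u, v} | u v. u \<in> S \<and> v \<in> S \<and> u \<noteq> v}\<rparr>"

definition path_graph :: "nat \<Rightarrow> nat graph" where
  "path_graph n = \<lparr>verts = {1..n}, edges = {{i, Suc i} | i. 1 \<le> i \<and> Suc i \<le> n}\<rparr>"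

(* Meaningful as a join only when the two vertex sets are disjoint. *)
definition join_graph :: "'a graph \<Rightarrow> 'a graph \<Rightarrow> 'a graph" where
  "join_graph G H = \<lparr>verts = verts G \<union> verts H,
     edges = edges G \<union> edges H \<union> {{u, v} | u v. u \<in> verts G \<and> v \<in> verts H}\<rparr>"

definition fan_graph :: "nat \<Rightarrow> nat graph" where
  "fan_graph n = join_graph (complete_graph {0}) (path_graph n)"

lemma fan_graph_parts_disjoint:
  "verts (complete_graph {0::nat}) \<inter> verts (path_graph n) = {}"
  by (simp add: complete_graph_def path_graph_def)

lemma simple_graph_fan_graph: "simple_graph (fan_graph n)"
  by (auto simp: simple_graph_def fan_graph_def join_graph_def complete_graph_def path_graph_def)

definition cycle_edges :: "'a list \<Rightarrow> 'a set set" where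
  "cycle_edges xs = {{xs ! i, xs ! (Suc i mod length xs)} | i. i < length xs}"

definition is_cycle :: "'a graph \<Rightarrow> 'a list \<Rightarrow> bool" where
  "is_cycle G xs \<longleftrightarrow> 3 \<le> length xs \<and> distinct xs \<and> set xs \<subseteq> verts G \<and> cycle_edges xs \<subseteq> edges G"

(* Extensional functions, so that a signature is determined by its values on the edges
   and counting signatures (or classes of them) is meaningful. *)
definition signatures :: "'a graph \<Rightarrow> ('a set \<Rightarrow> int) set" where
  "signatures G = edges G \<rightarrow>\<^sub>E {1, -1}"

(* Only the values of \<sigma> on the edges of G matter, so a signature of a graph can be
   used unchanged as a signature of an edge-deleted subgraph. *)
definition balanced :: "'a graph \<Rightarrow> ('a set \<Rightarrow> int) \<Rightarrow> bool" where
  "balanced G \<sigma> \<longleftrightarrow> (\<forall>xs. is_cycle G xs \<longrightarrow> (\<Prod>e\<in>cycle_edges xs. \<sigma> e) = 1)"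

definition frustration_index :: "'a graph \<Rightarrow> ('a set \<Rightarrow> int) \<Rightarrow> nat" where
  "frustration_index G \<sigma> = Min (card ` {D. D \<subseteq> edges G \<and> balanced (delete_edges G D) \<sigma>})"

definition max_frustration :: "'a graph \<Rightarrow> nat" where
  "max_frustration G = Max (frustration_index G ` signatures G)"

definition switch :: "'a graph \<Rightarrow> 'a set \<Rightarrow> ('a set \<Rightarrow> int) \<Rightarrow> ('a set \<Rightarrow> int)" where
  "switch G X \<sigma> = (\<lambda>e\<in>edges G. if card (e \<inter> X) = 1 then - \<sigma> e else \<sigma> e)"

definition switching_rel :: "'a graph \<Rightarrow> (('a set \<Rightarrow> int) \<times> ('a set \<Rightarrow> int)) set" where
  "switching_rel G = {(\<sigma>, \<tau>). \<sigma> \<in> signatures G \<and> \<tau> \<in> signatures G \<and>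
     (\<exists>X\<subseteq>verts G. \<tau> = switch G X \<sigma>)}"

definition switching_classes :: "'a graph \<Rightarrow> ('a set \<Rightarrow> int) set set" where
  "switching_classes G = signatures G // switching_rel G"

definition max_frustrated_classes :: "'a graph \<Rightarrow> ('a set \<Rightarrow> int) set set" where
  "max_frustrated_classes G =
     {C \<in> switching_classes G. \<forall>\<sigma>\<in>C. frustration_index G \<sigma> = max_frustration G}"

end

theory Submission imports Defs begin

text \<open>
  A switching class of the fan is determined by the set of its negative triangles, read as a
  word along the path. Consecutive negative triangles share a spoke, so the frustration index
  is found greedily from the left: a negative triangle costs one edge, and the same edge can be
  used to repair the next triangle if that is negative, too. The lower bound comes from the
  edge-disjoint negative triangles met by the greedy scan, the upper bound from an explicit
  switching with few negative edges. The extremal words are those in which the scan (which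
  swallows two letters per negative triangle) wastes as few letters as possible.
\<close>

section \<open>The greedy scan of Boolean words\<close>

fun greedy :: "bool list \<Rightarrow> nat" where
  "greedy [] = 0"
| "greedy (False # ts) = greedy ts"
| "greedy [True] = 1"
| "greedy (True # t # ts) = Suc (greedy ts)"

text \<open>Every unit counted consumes two letters, except that a final lone \<open>True\<close>
  consumes only one.\<close>

lemma greedy_le: "2 * greedy ts \<le> length ts + 1"
  by (induction ts rule: greedy.induct) auto

lemma greedy_replicate_True: "greedy (replicate m True) = (m + 1) div 2"
proof (induction m rule: less_induct)
  case (less m)
  show ?case
  proof (cases "m < 2")
    case True
    then have "m = 0 \<or> m = 1" by auto
    then show ?thesis by auto
  next
    case False
    then obtain k where "m = Suc (Suc k)" by (metis add_2_eq_Suc le_Suc_ex not_less)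
    with less.IH[of k] show ?thesis by simp
  qed
qed

text \<open>\<open>P\<close> collects the positions at which the scan counts. The letter after such
  a position is skipped, so no two are adjacent, and in the fan the corresponding negative triangles
  share no edge.\<close>

lemma greedy_independent:
  "\<exists>P. P \<subseteq> {i. i < length ts \<and> ts ! i} \<and> (\<forall>i\<in>P. Suc i \<notin> P) \<and> card P = greedy ts"
proof (induction ts rule: greedy.induct)
  case 1
  then show ?case by (intro exI[of _ "{}"]) auto
next
  case (2 ts)
  then obtain P where P: "P \<subseteq> {i. i < length ts \<and> ts ! i}" "\<forall>i\<in>P. Suc i \<notin> P"
    "card P = greedy ts" by blast
  then show ?case by (intro exI[of _ "Suc ` P"]) (auto simp: card_image)
next
  case 3
  then show ?case by (intro exI[of _ "{0}"]) auto
next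
  case (4 t ts)
  then obtain P where P: "P \<subseteq> {i. i < length ts \<and> ts ! i}" "\<forall>i\<in>P. Suc i \<notin> P"
    "card P = greedy ts" by blast
  have "finite P" using P(1) by (rule finite_subset) auto
  then have "card (insert 0 ((\<lambda>i. Suc (Suc i)) ` P)) = Suc (greedy ts)"
    using P(3) by (subst card_insert_disjoint) (auto simp: card_image inj_on_def)
  then show ?case
    using P(1,2) by (intro exI[of _ "insert 0 ((\<lambda>i. Suc (Suc i)) ` P)"]) auto
qed

text \<open>Here \<open>r i\<close> says that spoke \<open>i\<close> is negative after a switching.
  As triangle \<open>i\<close> keeps its sign \<open>ts ! i\<close>, path edge \<open>i\<close> is
  then negative iff \<open>(r i \<noteq> r (Suc i)) \<noteq> ts ! i\<close>, so the two sums count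
  the negative edges. The clause \<open>\<not> r 0\<close> strengthens the induction: a positive
  first spoke lets earlier letters be prepended at no further cost.\<close>

lemma greedy_potential:
  "\<exists>r. \<not> r 0 \<and> (\<Sum>i\<le>length ts. of_bool (r i)) +
     (\<Sum>i<length ts. of_bool ((r i \<noteq> r (Suc i)) \<noteq> ts ! i)) \<le> greedy ts"
proof (induction ts rule: greedy.induct)
  case 1
  then show ?case by (intro exI[of _ "\<lambda>_. False"]) auto
next
  case (2 ts)
  then obtain r where r: "\<not> r 0" "(\<Sum>i\<le>length ts. of_bool (r i)) +
     (\<Sum>i<length ts. of_bool ((r i \<noteq> r (Suc i)) \<noteq> ts ! i)) \<le> greedy ts" by blast
  then show ?case
    by (intro exI[of _ "case_nat False r"])
      (simp add: sum.atMost_Suc_shift sum.lessThan_Suc_shift del: sum.atMost_Suc sum.lessThan_Suc)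
next
  case 3
  then show ?case by (intro exI[of _ "\<lambda>_. False"]) auto
next
  case (4 t ts)
  then obtain r where r: "\<not> r 0" "(\<Sum>i\<le>length ts. of_bool (r i)) +
     (\<Sum>i<length ts. of_bool ((r i \<noteq> r (Suc i)) \<noteq> ts ! i)) \<le> greedy ts" by blast
  then show ?case
    \<comment> \<open>If \<open>t\<close> holds, the spoke shared by the two negative triangles pays
      for both; otherwise the path edge of the first triangle pays.\<close>
    by (intro exI[of _ "case_nat False (case_nat t r)"])
      (cases t; simp add: sum.atMost_Suc_shift sum.lessThan_Suc_shift
         del: sum.atMost_Suc sum.lessThan_Suc)
qed

section \<open>Counting words by length and greedy value\<close>

definition words :: "nat \<Rightarrow> nat \<Rightarrow> bool list set" where
  "words m k = {ts. length ts = m \<and> greedy ts = k}"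

lemma finite_words: "finite (words m k)"
  by (rule finite_subset[OF _ finite_lists_length_eq[of UNIV m]]) (auto simp: words_def)

lemma words_empty: "m + 1 < 2 * k \<Longrightarrow> words m k = {}"
proof -
  have False if "m + 1 < 2 * k" "length ts = m" "greedy ts = k" for ts
    using that greedy_le[of ts] by simp
  then show "m + 1 < 2 * k \<Longrightarrow> words m k = {}" by (auto simp: words_def)
qed

text \<open>Split by the first letter: \<open>False\<close> is dropped for free, while
  \<open>True\<close> costs one unit and swallows an arbitrary second letter, whence the factor
  2.\<close>

lemma card_words_step:
  "card (words (Suc (Suc m)) (Suc k)) = card (words (Suc m) (Suc k)) + 2 * card (words m k)"
proof -
  have *: "words (Suc (Suc m)) (Suc k) = (#) False ` words (Suc m) (Suc k) \<union>
     ((\<lambda>ts. True # True # ts) ` words m k \<union> (\<lambda>ts. True # False # ts) ` words m k)"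
    (is "_ = ?A \<union> (?B \<union> ?C)")
  proof (intro equalityI subsetI)
    fix ts assume ts: "ts \<in> words (Suc (Suc m)) (Suc k)"
    then obtain a b us where "ts = a # b # us"
      unfolding words_def by (auto simp: length_Suc_conv)
    with ts show "ts \<in> ?A \<union> (?B \<union> ?C)"
      by (cases a; cases b) (auto simp: words_def image_iff)
  qed (auto simp: words_def)
  have fin: "finite ?A" "finite ?B" "finite ?C" by (simp_all add: finite_words)
  have "card (?A \<union> (?B \<union> ?C)) = card ?A + (card ?B + card ?C)"
    using fin by (subst card_Un_disjoint; (subst card_Un_disjoint)?) auto
  then show ?thesis unfolding * by (simp add: card_image inj_on_def)
qed

lemma words_0: "words 0 k = (if k = 0 then {[]} else {})"
  by (auto simp: words_def)

lemma words_1_1: "words (Suc 0) (Suc 0) = {[True]}"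
proof -
  have "ts = [True]" if "length ts = Suc 0" "greedy ts = Suc 0" for ts
    using that by (cases "hd ts") (auto simp: length_Suc_conv)
  then show ?thesis by (auto simp: words_def)
qed

text \<open>At odd length the bound of \<open>greedy_le\<close> is tight, so no letter can be
  wasted: the branch starting with \<open>False\<close> is empty and the recurrence only
  doubles.\<close>

lemma card_words_odd: "card (words (Suc (2 * k)) (Suc k)) = 2 ^ k"
proof (induction k)
  case (Suc k)
  have "words (Suc (Suc (2 * k))) (Suc (Suc k)) = {}" by (rule words_empty) simp
  then show ?case using Suc card_words_step[of "Suc (2 * k)" "Suc k"] by simp
qed (simp add: words_1_1)

text \<open>Even length leaves room for one wasted letter, so the odd count enters as the
  inhomogeneous term of the recurrence. Doubling avoids the exponent \<open>k - 1\<close>, which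
  would be truncated at \<open>k = 0\<close>.\<close>

lemma card_words_even: "2 * card (words (2 * k) k) = (k + 2) * 2 ^ k"
proof (induction k)
  case (Suc k)
  have "card (words (2 * Suc k) (Suc k)) = 2 ^ k + 2 * card (words (2 * k) k)"
    using card_words_step[of "2 * k" k] card_words_odd[of k] by simp
  with Suc show ?case by simp
qed (simp add: words_0)

subsection \<open>Balance\<close>

text \<open>Equal edges at distinct positions would force each position to be the cyclic successor
  of the other, which length at least 3 excludes. This turns products over the edge set into
  products over indices.\<close>

lemma inj_on_cycle_edges:
  assumes "3 \<le> length xs" "distinct xs"
  shows "inj_on (\<lambda>i. {xs ! i, xs ! (Suc i mod length xs)}) {..<length xs}"
proof (rule inj_onI)
  fix i j
  let ?n = "length xs"
  assume i: "i \<in> {..<?n}" and j: "j \<in> {..<?n}"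
    and eq: "{xs ! i, xs ! (Suc i mod ?n)} = {xs ! j, xs ! (Suc j mod ?n)}"
  have lt: "Suc i mod ?n < ?n" "Suc j mod ?n < ?n" 
    using assms(1) by (auto intro!: mod_less_divisor simp del: length_greater_0_conv)
  have "i = j \<or> (i = Suc j mod ?n \<and> Suc i mod ?n = j)"
    using eq i j lt assms(2) by (auto simp: doubleton_eq_iff nth_eq_iff_index_eq)
  moreover have "\<not> (i = Suc j mod ?n \<and> Suc i mod ?n = j)"
    using i j assms(1) by (auto simp: mod_Suc split: if_splits)
  ultimately show "i = j" by blast
qed

text \<open>The easy half of Harary's criterion: along a cycle each vertex lies on two edges, so its
  factor \<open>s v\<close> occurs squared.\<close>

lemma balancedI_potential:
  fixes s :: "'a \<Rightarrow> int"
  assumes s: "\<And>v. s v * s v = 1"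
    and \<sigma>: "\<And>u v. {u, v} \<in> edges G \<Longrightarrow> \<sigma> {u, v} = s u * s v"
  shows "balanced G \<sigma>"
  unfolding balanced_def
proof (intro allI impI)
  fix xs assume xs: "is_cycle G xs"
  let ?n = "length xs"
  let ?e = "\<lambda>i. {xs ! i, xs ! (Suc i mod ?n)}"
  from xs have n: "3 \<le> ?n" and dist: "distinct xs" and sub: "cycle_edges xs \<subseteq> edges G"
    by (auto simp: is_cycle_def)
  have ce: "cycle_edges xs = ?e ` {..<?n}" by (auto simp: cycle_edges_def)
  have bij: "bij_betw (\<lambda>i. Suc i mod ?n) {..<?n} {..<?n}"
  proof (rule bij_betwI[where g = "\<lambda>i. if i = 0 then ?n - 1 else i - 1"])
  qed (use n in \<open>auto simp: mod_Suc split: if_splits\<close>)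
  have "(\<Prod>e\<in>cycle_edges xs. \<sigma> e) = (\<Prod>i<?n. \<sigma> (?e i))"
    unfolding ce by (subst prod.reindex[OF inj_on_cycle_edges[OF n dist]]) simp
  also have "\<dots> = (\<Prod>i<?n. s (xs ! i) * s (xs ! (Suc i mod ?n)))"
  proof (rule prod.cong[OF refl])
    fix i assume "i \<in> {..<?n}"
    then have "?e i \<in> edges G" using sub unfolding ce by blast
    then show "\<sigma> (?e i) = s (xs ! i) * s (xs ! (Suc i mod ?n))" by (rule \<sigma>)
  qed
  also have "\<dots> = (\<Prod>i<?n. s (xs ! i)) * (\<Prod>i<?n. s (xs ! (Suc i mod ?n)))"
    by (rule prod.distrib)
  also have "(\<Prod>i<?n. s (xs ! (Suc i mod ?n))) = (\<Prod>i<?n. s (xs ! i))"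
    by (rule prod.reindex_bij_betw[OF bij])
  finally show "(\<Prod>e\<in>cycle_edges xs. \<sigma> e) = 1"
    by (simp add: prod.distrib[symmetric] s)
qed

lemma balanced_triangle:
  assumes "balanced G \<sigma>" "{u, v, w} \<subseteq> verts G" "u \<noteq> v" "v \<noteq> w" "u \<noteq> w"
    and "{u, v} \<in> edges G" "{v, w} \<in> edges G" "{u, w} \<in> edges G"
  shows "\<sigma> {u, v} * \<sigma> {v, w} * \<sigma> {u, w} = 1"
proof -
  have ce: "cycle_edges [u, v, w] = {{u, v}, {v, w}, {u, w}}"
  proof -
    have "cycle_edges [u, v, w] =
        (\<lambda>i. {[u, v, w] ! i, [u, v, w] ! (Suc i mod 3)}) ` {..<3}"
      by (auto simp: cycle_edges_def)
    also have "{..<3} = {0, 1, 2 :: nat}" by auto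
    finally show ?thesis by (simp add: insert_commute[of w u "{}"])
  qed
  have "is_cycle G [u, v, w]" using assms ce by (auto simp: is_cycle_def)
  then have "(\<Prod>e\<in>cycle_edges [u, v, w]. \<sigma> e) = 1" using assms(1) unfolding balanced_def by blast
  then show ?thesis unfolding ce using assms(3-5) by (auto simp: doubleton_eq_iff mult.assoc)
qed

lemma frustration_index_le:
  assumes "finite (edges G)" "D \<subseteq> edges G" "balanced (delete_edges G D) \<sigma>"
  shows "frustration_index G \<sigma> \<le> card D"
  unfolding frustration_index_def
proof (rule Min_le)
  show "finite (card ` {D. D \<subseteq> edges G \<and> balanced (delete_edges G D) \<sigma>})"
    using assms(1) by simp
qed (use assms in auto)

lemma le_frustration_index:
  assumes "finite (edges G)"
    and le: "\<And>D. D \<subseteq> edges G \<Longrightarrow> balanced (delete_edges G D) \<sigma> \<Longrightarrow> k \<le> card D"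
  shows "k \<le> frustration_index G \<sigma>"
  unfolding frustration_index_def
proof (rule Min.boundedI)
  show "finite (card ` {D. D \<subseteq> edges G \<and> balanced (delete_edges G D) \<sigma>})"
    using assms(1) by simp
  \<comment> \<open>Deleting every edge is always admissible, so the minimum is over a nonempty
    set.\<close>
  have "balanced (delete_edges G (edges G)) \<sigma>"
    by (rule balancedI_potential[where s = "\<lambda>_. 1"]) (auto simp: delete_edges_def)
  then show "card ` {D. D \<subseteq> edges G \<and> balanced (delete_edges G D) \<sigma>} \<noteq> {}" by blast
qed (use le in auto)

subsection \<open>The fan\<close>

lemma verts_fan: "verts (fan_graph (Suc m)) = {..Suc m}"
  by (auto simp: fan_graph_def join_graph_def complete_graph_def path_graph_def)

text \<open>Writing the order of the path as \<open>Suc m\<close> gives \<open>m\<close> triangles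
  and indexes spokes and path edges from 0, in step with list positions; the hub is 0.\<close>

lemma edges_fan: "edges (fan_graph (Suc m)) =
    (\<lambda>i. {0, Suc i}) ` {..m} \<union> (\<lambda>i. {Suc i, Suc (Suc i)}) ` {..<m}"
proof -
  have "{{i, Suc i} | i. 1 \<le> i \<and> Suc i \<le> Suc m} = (\<lambda>i. {i, Suc i}) ` Suc ` {..<m}"
    by (subst image_Suc_lessThan) auto
  moreover have "{{u, v} | u v. u \<in> {0::nat} \<and> v \<in> {1..Suc m}} = (\<lambda>v. {0, v}) ` Suc ` {..m}"
    by (subst image_Suc_atMost) auto
  moreover have "edges (complete_graph {0::nat}) = {}" by (auto simp: complete_graph_def)
  ultimately show ?thesis
    by (simp add: fan_graph_def join_graph_def path_graph_def complete_graph_def image_image Un_commute)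
qed

lemma finite_edges_fan: "finite (edges (fan_graph (Suc m)))"
  by (simp add: edges_fan)

lemma spoke_in_edges: "i \<le> m \<Longrightarrow> {0, Suc i} \<in> edges (fan_graph (Suc m))"
  by (auto simp: edges_fan)

lemma path_edge_in_edges: "i < m \<Longrightarrow> {Suc i, Suc (Suc i)} \<in> edges (fan_graph (Suc m))"
  by (auto simp: edges_fan)

section \<open>Triangle words and the frustration index\<close>

definition triangle_word :: "nat \<Rightarrow> (nat set \<Rightarrow> int) \<Rightarrow> bool list" where
  "triangle_word m \<sigma> =
     map (\<lambda>i. \<sigma> {0, Suc i} * \<sigma> {Suc i, Suc (Suc i)} * \<sigma> {0, Suc (Suc i)} = -1) [0..<m]"

lemma length_triangle_word [simp]: "length (triangle_word m \<sigma>) = m"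
  by (simp add: triangle_word_def)

lemma nth_triangle_word: "i < m \<Longrightarrow> triangle_word m \<sigma> ! i \<longleftrightarrow>
    \<sigma> {0, Suc i} * \<sigma> {Suc i, Suc (Suc i)} * \<sigma> {0, Suc (Suc i)} = -1"
  by (simp add: triangle_word_def)

lemma signature_values: "\<sigma> \<in> signatures G \<Longrightarrow> e \<in> edges G \<Longrightarrow> \<sigma> e = 1 \<or> \<sigma> e = -1"
  by (auto simp: signatures_def)

text \<open>Each negative triangle selected by \<open>greedy_independent\<close> must lose an edge,
  and edge-disjointness makes the choice \<open>d\<close> of a lost edge injective.\<close>

lemma frustration_fan_ge:
  "greedy (triangle_word m \<sigma>) \<le> frustration_index (fan_graph (Suc m)) \<sigma>"
proof (rule le_frustration_index[OF finite_edges_fan])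
  let ?G = "fan_graph (Suc m)"
  let ?T = "\<lambda>i. {{0, Suc i}, {Suc i, Suc (Suc i)}, {0, Suc (Suc i)}}"
  fix D assume D: "D \<subseteq> edges ?G" and bal: "balanced (delete_edges ?G D) \<sigma>"
  obtain P where P: "P \<subseteq> {i. i < m \<and> triangle_word m \<sigma> ! i}" "\<forall>i\<in>P. Suc i \<notin> P"
    "card P = greedy (triangle_word m \<sigma>)"
    using greedy_independent[of "triangle_word m \<sigma>"] by auto
  have "\<exists>e. e \<in> D \<inter> ?T i" if "i \<in> P" for i
  proof (rule ccontr)
    assume "\<nexists>e. e \<in> D \<inter> ?T i"
    moreover have i: "i < m" "triangle_word m \<sigma> ! i" using that P(1) by auto
    ultimately have "\<sigma> {0, Suc i} * \<sigma> {Suc i, Suc (Suc i)} * \<sigma> {0, Suc (Suc i)} = 1"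
      using spoke_in_edges[of i m] spoke_in_edges[of "Suc i" m] path_edge_in_edges[of i m]
      by (intro balanced_triangle[OF bal]) (auto simp: delete_edges_def verts_fan)
    with i show False by (simp add: nth_triangle_word)
  qed
  then have "\<forall>i\<in>P. \<exists>e. e \<in> D \<inter> ?T i" by (rule ballI)
  from bchoice[OF this] obtain d where d: "\<forall>i\<in>P. d i \<in> D \<inter> ?T i" by (rule exE)
  have "inj_on d P"
  proof (rule inj_onI)
    fix i j assume ij: "i \<in> P" "j \<in> P" "d i = d j"
    then have "d i \<in> ?T i \<inter> ?T j" using d by (metis IntD2 IntI)
    then have "?T i \<inter> ?T j \<noteq> {}" by blast
    \<comment> \<open>Only consecutive triangles have a common edge, namely a spoke.\<close>
    then have "i = j \<or> i = Suc j \<or> j = Suc i" by (auto simp: doubleton_eq_iff)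
    with ij P(2) show "i = j" by blast
  qed
  moreover have "finite D" using D finite_edges_fan finite_subset by blast
  ultimately have "card P \<le> card D" using d by (intro card_inj_on_le[of d]) auto
  with P(3) show "greedy (triangle_word m \<sigma>) \<le> card D" by simp
qed

text \<open>The edges that stay negative under the switching encoded by
  \<open>greedy_potential\<close> are deleted; the rest carries a vertex potential.\<close>

lemma frustration_fan_le:
  assumes \<sigma>: "\<sigma> \<in> signatures (fan_graph (Suc m))"
  shows "frustration_index (fan_graph (Suc m)) \<sigma> \<le> greedy (triangle_word m \<sigma>)"
proof -
  let ?G = "fan_graph (Suc m)"
  let ?w = "triangle_word m \<sigma>"
  obtain r where r: "(\<Sum>i\<le>m. of_bool (r i)) +
     (\<Sum>i<m. of_bool ((r i \<noteq> r (Suc i)) \<noteq> ?w ! i)) \<le> greedy ?w"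
    using greedy_potential[of ?w] by auto
  define I J where "I = {i. i \<le> m \<and> r i}" and "J = {i. i < m \<and> (r i \<noteq> r (Suc i)) \<noteq> ?w ! i}"
  define D where "D = (\<lambda>i. {0, Suc i}) ` I \<union> (\<lambda>i. {Suc i, Suc (Suc i)}) ` J"
  have D: "D \<subseteq> edges ?G" by (auto simp: D_def I_def J_def edges_fan)
  have fin: "finite I" "finite J" by (auto simp: I_def J_def)
  have "card I = (\<Sum>i\<le>m. of_bool (r i))" "card J = (\<Sum>i<m. of_bool ((r i \<noteq> r (Suc i)) \<noteq> ?w ! i))"
    unfolding I_def J_def by (auto simp: sum.If_cases of_bool_def Int_def intro!: arg_cong[of _ _ card])
  moreover have "card D \<le> card I + card J"
    unfolding D_def using fin by (meson add_mono card_Un_le card_image_le le_trans)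
  ultimately have card: "card D \<le> greedy ?w" using r by linarith
  \<comment> \<open>Thus \<open>s v\<close> equals \<open>\<sigma> {0, v}\<close>, negated exactly
    when \<open>r\<close> marks that spoke for deletion. The shift \<open>v - 1\<close> is needed
    because path vertices start at 1 and \<open>r\<close> at 0.\<close>
  define s where "s v = (if v = 0 then 1 else
      if \<not> (r (v - 1)) = (\<sigma> {0, v} = 1) then 1 else -1 :: int)" for v
  have val: "\<sigma> e = 1 \<or> \<sigma> e = -1" if "e \<in> edges ?G" for e
    using \<sigma> that by (rule signature_values)
  have "balanced (delete_edges ?G D) \<sigma>"
  proof (rule balancedI_potential[where s = s])
    show "s v * s v = 1" for v by (simp add: s_def)
    fix u v assume "{u, v} \<in> edges (delete_edges ?G D)"
    then have e: "{u, v} \<in> edges ?G" "{u, v} \<notin> D" by (auto simp: delete_edges_def)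
    \<comment> \<open>The edge is first treated in a fixed orientation, since \<open>u\<close> and
      \<open>v\<close> may occur in either order.\<close>
    have "\<sigma> {x, y} = s x * s y" if "{x, y} = {u, v}" "(x = 0 \<and> y = Suc i \<and> i \<le> m) \<or>
       (x = Suc i \<and> y = Suc (Suc i) \<and> i < m)" for x y i
      using that(2)
    proof (elim disjE conjE)
      assume x: "x = 0" "y = Suc i" "i \<le> m"
      then have "\<not> r i" using e(2) unfolding that(1)[symmetric] by (auto simp: D_def I_def)
      then show ?thesis using x val[OF spoke_in_edges[of i m]] by (auto simp: s_def)
    next
      assume x: "x = Suc i" "y = Suc (Suc i)" "i < m"
      then have "(r i \<noteq> r (Suc i)) = ?w ! i" using e(2) unfolding that(1)[symmetric] by (auto simp: D_def J_def)
      then show ?thesis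
        using x val[OF spoke_in_edges[of i m]] val[OF spoke_in_edges[of "Suc i" m]]
          val[OF path_edge_in_edges[of i m]]
        by (auto simp: s_def nth_triangle_word)
    qed
    moreover from e(1) obtain x y i where "{x, y} = {u, v}" "(x = 0 \<and> y = Suc i \<and> i \<le> m) \<or>
       (x = Suc i \<and> y = Suc (Suc i) \<and> i < m)"
      unfolding edges_fan by fastforce
    ultimately have "\<sigma> {x, y} = s x * s y" "{x, y} = {u, v}" by blast+
    then show "\<sigma> {u, v} = s u * s v" by (auto simp: doubleton_eq_iff insert_commute)
  qed
  with D have "frustration_index ?G \<sigma> \<le> card D" by (intro frustration_index_le finite_edges_fan)
  with card show ?thesis by simp
qed

lemma frustration_fan:
  "\<sigma> \<in> signatures (fan_graph (Suc m)) \<Longrightarrow>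
     frustration_index (fan_graph (Suc m)) \<sigma> = greedy (triangle_word m \<sigma>)"
  by (intro antisym frustration_fan_le frustration_fan_ge)

text \<open>With all spokes positive, the sign of each path edge alone decides the sign of its
  triangle.\<close>

lemma triangle_word_surj:
  assumes "length ts = m"
  shows "\<exists>\<sigma>\<in>signatures (fan_graph (Suc m)). triangle_word m \<sigma> = ts"
proof -
  define \<sigma> :: "nat set \<Rightarrow> int" where "\<sigma> = (\<lambda>e\<in>edges (fan_graph (Suc m)).
    if \<exists>i<m. e = {Suc i, Suc (Suc i)} \<and> ts ! i then -1 else 1)"
  have "\<sigma> \<in> signatures (fan_graph (Suc m))" by (simp add: \<sigma>_def signatures_def)
  moreover have "triangle_word m \<sigma> = ts"
  proof (rule nth_equalityI)
    fix i assume "i < length (triangle_word m \<sigma>)"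
    then have i: "i < m" by simp
    have "\<sigma> {0, Suc i} = 1" "\<sigma> {0, Suc (Suc i)} = 1"
      "\<sigma> {Suc i, Suc (Suc i)} = (if ts ! i then -1 else 1)"
      unfolding \<sigma>_def using i spoke_in_edges[of i m] spoke_in_edges[of "Suc i" m]
        path_edge_in_edges[of i m] by (auto simp: doubleton_eq_iff)
    with i show "triangle_word m \<sigma> ! i = ts ! i" by (simp add: nth_triangle_word)
  qed (simp add: assms)
  ultimately show ?thesis by blast
qed

section \<open>Switching classes of the fan\<close>

lemma switch_edge:
  assumes "{u, v} \<in> edges G" "u \<noteq> v"
  shows "switch G X \<sigma> {u, v} = (if (u \<in> X) \<noteq> (v \<in> X) then - \<sigma> {u, v} else \<sigma> {u, v})"
proof -
  have "card ({u, v} \<inter> X) = 1 \<longleftrightarrow> (u \<in> X) \<noteq> (v \<in> X)"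
    using assms(2) by (cases "u \<in> X"; cases "v \<in> X") (auto simp: Int_insert_left)
  with assms(1) show ?thesis by (simp add: switch_def)
qed

text \<open>Switching negates an even number of edges of every triangle.\<close>

lemma triangle_word_switch: "triangle_word m (switch (fan_graph (Suc m)) X \<sigma>) = triangle_word m \<sigma>"
proof (rule nth_equalityI)
  fix i assume "i < length (triangle_word m (switch (fan_graph (Suc m)) X \<sigma>))"
  then have i: "i < m" by simp
  then have "{0, Suc i} \<in> edges (fan_graph (Suc m))" "{0, Suc (Suc i)} \<in> edges (fan_graph (Suc m))"
    "{Suc i, Suc (Suc i)} \<in> edges (fan_graph (Suc m))"
    using spoke_in_edges[of i m] spoke_in_edges[of "Suc i" m] path_edge_in_edges[of i m] by auto
  with i show "triangle_word m (switch (fan_graph (Suc m)) X \<sigma>) ! i = triangle_word m \<sigma> ! i"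
    by (simp add: nth_triangle_word switch_edge)
qed simp

text \<open>The triangle word is a complete invariant: once switching has made the spokes agree, the
  triangle signs determine the path edges.\<close>

lemma switching_rel_fan: "switching_rel (fan_graph (Suc m)) =
    {(\<sigma>, \<tau>). \<sigma> \<in> signatures (fan_graph (Suc m)) \<and> \<tau> \<in> signatures (fan_graph (Suc m)) \<and>
       triangle_word m \<sigma> = triangle_word m \<tau>}"
proof -
  let ?G = "fan_graph (Suc m)"
  have "\<exists>X\<subseteq>verts ?G. \<tau> = switch ?G X \<sigma>"
    if \<sigma>: "\<sigma> \<in> signatures ?G" and \<tau>: "\<tau> \<in> signatures ?G"
      and eq: "triangle_word m \<sigma> = triangle_word m \<tau>" for \<sigma> \<tau>
  proof (intro exI conjI)
    \<comment> \<open>Leaving the hub out of \<open>?X\<close> makes each spoke flip exactly when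
      its outer end is in \<open>?X\<close>.\<close>
    let ?X = "{v \<in> verts ?G. v \<noteq> 0 \<and> \<sigma> {0, v} \<noteq> \<tau> {0, v}}"
    show "?X \<subseteq> verts ?G" by blast
    show "\<tau> = switch ?G ?X \<sigma>"
    proof
      fix e
      note val = signature_values[OF \<sigma>] signature_values[OF \<tau>]
      consider "e \<notin> edges ?G" | i where "e = {0, Suc i}" "i \<le> m"
        | i where "e = {Suc i, Suc (Suc i)}" "i < m"
        unfolding edges_fan by fastforce
      then show "\<tau> e = switch ?G ?X \<sigma> e"
      proof cases
        case 1
        with \<tau> show ?thesis by (auto simp: signatures_def switch_def)
      next
        case 2
        then show ?thesis
          using val[OF spoke_in_edges[of i m]] by (auto simp: switch_edge spoke_in_edges verts_fan)
      next
        case 3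
        let ?a = "{0, Suc i}" and ?b = "{0, Suc (Suc i)}"
        have in_edges: "?a \<in> edges ?G" "?b \<in> edges ?G" "e \<in> edges ?G"
          using 3 spoke_in_edges[of i m] spoke_in_edges[of "Suc i" m] path_edge_in_edges[of i m]
          by auto
        have "switch ?G ?X \<sigma> e = (if (\<sigma> ?a \<noteq> \<tau> ?a) \<noteq> (\<sigma> ?b \<noteq> \<tau> ?b) then - \<sigma> e else \<sigma> e)"
          using 3 in_edges by (simp add: switch_edge verts_fan)
        moreover have "\<sigma> ?a * \<sigma> e * \<sigma> ?b = -1 \<longleftrightarrow> \<tau> ?a * \<tau> e * \<tau> ?b = -1"
          using 3 eq nth_triangle_word[of i m \<sigma>] nth_triangle_word[of i m \<tau>] by simp
        ultimately show ?thesis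
          using val[OF in_edges(1)] val[OF in_edges(2)] val[OF in_edges(3)]
          by (elim disjE) simp_all
      qed
    qed
  qed
  then show ?thesis unfolding switching_rel_def by (auto simp: triangle_word_switch)
qed

section \<open>Counting the extremal classes\<close>

lemma max_frustration_fan: "max_frustration (fan_graph (Suc m)) = (m + 1) div 2"
  unfolding max_frustration_def
proof (rule Max_eqI)
  let ?G = "fan_graph (Suc m)"
  show "finite (frustration_index ?G ` signatures ?G)"
    by (simp add: signatures_def finite_PiE finite_edges_fan)
  show "y \<le> (m + 1) div 2" if "y \<in> frustration_index ?G ` signatures ?G" for y
  proof -
    from that obtain \<sigma> where "y = greedy (triangle_word m \<sigma>)" by (auto simp: frustration_fan)
    with greedy_le[of "triangle_word m \<sigma>"] show ?thesis by simp
  qed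
  obtain \<sigma> where "\<sigma> \<in> signatures ?G" "triangle_word m \<sigma> = replicate m True"
    using triangle_word_surj[of "replicate m True" m] by auto
  then show "(m + 1) div 2 \<in> frustration_index ?G ` signatures ?G"
    by (intro image_eqI[of _ _ \<sigma>]) (simp_all add: frustration_fan greedy_replicate_True)
qed

text \<open>Switching classes are the fibres \<open>F ts\<close> of \<open>triangle_word\<close>
  over the words of length \<open>m\<close>, and on each fibre the frustration index is constantly
  \<open>greedy ts\<close>.\<close>

lemma card_max_frustrated_fan:
  "card (max_frustrated_classes (fan_graph (Suc m))) = card (words m ((m + 1) div 2))"
proof -
  let ?G = "fan_graph (Suc m)"
  define F where "F ts = {\<sigma> \<in> signatures ?G. ts = triangle_word m \<sigma>}" for ts
  have ne: "\<exists>\<sigma>. \<sigma> \<in> F ts" if "length ts = m" for ts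
    using triangle_word_surj[OF that] by (auto simp: F_def)
  have "switching_classes ?G = (\<lambda>\<sigma>. F (triangle_word m \<sigma>)) ` signatures ?G"
    unfolding switching_classes_def quotient_def switching_rel_fan F_def by auto
  also have "\<dots> = F ` {ts. length ts = m}"
    using triangle_word_surj by (force simp: image_iff)
  finally have cls: "switching_classes ?G = F ` {ts. length ts = m}" .
  \<comment> \<open>The fibre is nonempty, so the universal condition is not vacuous; nonemptiness
    also gives injectivity of \<open>F\<close> below.\<close>
  have "(\<forall>\<sigma>\<in>F ts. frustration_index ?G \<sigma> = max_frustration ?G) \<longleftrightarrow> greedy ts = (m + 1) div 2"
    if "length ts = m" for ts
    using ne[OF that] by (auto simp: F_def frustration_fan max_frustration_fan)
  then have "max_frustrated_classes ?G = F ` words m ((m + 1) div 2)"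
    unfolding max_frustrated_classes_def cls words_def by auto
  moreover have "inj_on F (words m ((m + 1) div 2))"
  proof (rule inj_onI)
    fix ts us assume "ts \<in> words m ((m + 1) div 2)" "F ts = F us"
    then show "ts = us" using ne[of ts] by (auto simp: words_def F_def)
  qed
  ultimately show ?thesis by (simp add: card_image)
qed

theorem corollary21:
  fixes n :: nat
  assumes "n \<ge> 1"
  shows "(even n \<longrightarrow>
            real (card (max_frustrated_classes (fan_graph n))) = 2 powr (real n / 2 - 1)) \<and>
         (odd n \<longrightarrow>
            real (card (max_frustrated_classes (fan_graph n))) =
              (real n + 3) / 2 * 2 powr ((real n - 3) / 2))"
proof (intro conjI impI)
  assume "even n"
  then obtain j where "n = 2 * j" by (rule evenE)
  \<comment> \<open>Positivity rules out \<open>n = 0\<close>; the word length is then the odd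
    number \<open>2 * k + 1\<close>.\<close>
  with assms obtain k where n: "n = Suc (Suc (2 * k))" by (cases j) auto
  have "card (max_frustrated_classes (fan_graph n)) = 2 ^ k"
    unfolding n card_max_frustrated_fan using card_words_odd[of k] by simp
  moreover have "real n / 2 - 1 = real k" by (simp add: n field_simps)
  ultimately show "real (card (max_frustrated_classes (fan_graph n))) = 2 powr (real n / 2 - 1)"
    by (simp add: powr_realpow)
next
  assume "odd n"
  then obtain k where n: "n = Suc (2 * k)" by (metis Suc_eq_plus1 oddE)
  have "2 * card (max_frustrated_classes (fan_graph n)) = (k + 2) * 2 ^ k"
    unfolding n card_max_frustrated_fan using card_words_even[of k] by simp
  then have "2 * real (card (max_frustrated_classes (fan_graph n))) = (real k + 2) * 2 ^ k"
    by (metis (mono_tags, lifting) of_nat_add of_nat_mult of_nat_numeral of_nat_power)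
  moreover have eqs: "(real n - 3) / 2 = real k - 1" "(real n + 3) / 2 = real k + 2"
    by (simp_all add: n field_simps)
  \<comment> \<open>For \<open>n = 1\<close> the exponent is -1, so the power is taken over the
    reals.\<close>
  moreover have pow: "2 powr (real k - 1) = 2 ^ k / 2" by (simp add: powr_diff powr_realpow)
  ultimately show "real (card (max_frustrated_classes (fan_graph n))) =
      (real n + 3) / 2 * 2 powr ((real n - 3) / 2)"
    unfolding eqs pow by simp
qed

end
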